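(* Let $(M_n)_{n\ge1}$, $M_n=(f_n(m,k))_{1\le m,k\le 2n}$, be the Delta sequence. Then, as formal power series in $x,y,z$, $$\sum_{n\ge1}\ \sum_{2\le m+1\le k\le 2n-1} f_n(m,k)\,\frac{x^{2n-k}}{(2n-k)!}\,\frac{y^{k-m-1}}{(k-m-1)!}\,\frac{z^{m-1}}{(m-1)!} =\frac{\sin(\sqrt2\,x)\,\sin(\sqrt2\,z)}{2\cos^2\!\big(\frac{x+y+z}{\sqrt2}\big)}.$$
   Context: Delta sequence. For $n\ge1$, $M_n=(f_n(m,k))_{1\le m,k\le 2n}$ is a $2n\times 2n$ matrix; by convention $f_n(m,k)=0$ if $(m,k)\notin[1,2n]^2$. Write $f_n(m,\bullet)=\sum_{k=1}^{2n}f_n(m,k)$ and $f_n(\bullet,k)=\sum_{m=1}^{2n}f_n(m,k)$. Let $L_n^{(1)}=\{(m,k):2\le k+1\le m\le 2n-2\}$ and $U_n^{(1)}=\{(m,k):2\le m+1\le k\le 2n-2\}$. The Delta sequence is the unique sequence $(M_n)_{n\ge1}$ of matrices with nonnegative integer entries such that $M_1=\begin{pmatrix}0&0\\1&0\end{pmatrix}$ and, for every $n\ge2$: (a) $f_n(m,m)=0$ for all $m$; (b) $f_n(m+2,k)-2f_n(m+1,k)+f_n(m,k)+2f_{n-1}(m,k)=0$ for $(m,k)\in L_n^{(1)}$; (c) $f_n(m,k+2)-2f_n(m,k+1)+f_n(m,k)+2f_{n-1}(m,k)=0$ for $(m,k)\in U_n^{(1)}$; (d) column $2n$ of $M_n$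 is zero, and column $2n-1$ is $(f_{n-1}(1,\bullet),\dots,f_{n-1}(2n-2,\bullet),0,0)$ read top to bottom; (e) row $2n$ of $M_n$ is $(f_{n-1}(1,\bullet),\dots,f_{n-1}(2n-2,\bullet),0,0)$ read left to right, and row $2n-1$ is $(f_{n-1}(1,\bullet)+f_{n-1}(\bullet,1),\dots,f_{n-1}(2n-2,\bullet)+f_{n-1}(\bullet,2n-2),0,0)$. (These conditions determine the sequence uniquely.) *)

theory Defs
  imports Complex_Main "HOL-Computational_Algebra.Formal_Power_Series"
begin

unbundle fps_syntax

text \<open>
  The entry \<open>f\<^sub>n(m,k)\<close> of the matrix \<open>M\<^sub>n\<close> is written \<open>f n m k\<close>; indices start at 1, and
  \<open>f 0\<close> plays no role. Entries are natural numbers, cast to \<open>int\<close> wherever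
  subtraction occurs.
\<close>

definition row_sum :: "(nat \<Rightarrow> nat \<Rightarrow> nat \<Rightarrow> nat) \<Rightarrow> nat \<Rightarrow> nat \<Rightarrow> nat" where
  "row_sum f n m = (\<Sum>k = 1..2 * n. f n m k)"

definition col_sum :: "(nat \<Rightarrow> nat \<Rightarrow> nat \<Rightarrow> nat) \<Rightarrow> nat \<Rightarrow> nat \<Rightarrow> nat" where
  "col_sum f n k = (\<Sum>m = 1..2 * n. f n m k)"

definition L1 :: "nat \<Rightarrow> (nat \<times> nat) set" where
  "L1 n = {(m, k). 2 \<le> k + 1 \<and> k + 1 \<le> m \<and> m \<le> 2 * n - 2}"

definition U1 :: "nat \<Rightarrow> (nat \<times> nat) set" where
  "U1 n = {(m, k). 2 \<le> m + 1 \<and> m + 1 \<le> k \<and> k \<le> 2 * n - 2}"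

definition delta_step :: "(nat \<Rightarrow> nat \<Rightarrow> nat \<Rightarrow> nat) \<Rightarrow> nat \<Rightarrow> bool" where
  "delta_step f n \<longleftrightarrow>
     (\<forall>m\<in>{1..2 * n}. f n m m = 0) \<and>
     (\<forall>(m, k)\<in>L1 n.
        int (f n (m + 2) k) - 2 * int (f n (m + 1) k) + int (f n m k)
          + 2 * int (f (n - 1) m k) = 0) \<and>
     (\<forall>(m, k)\<in>U1 n.
        int (f n m (k + 2)) - 2 * int (f n m (k + 1)) + int (f n m k)
          + 2 * int (f (n - 1) m k) = 0) \<and>
     (\<forall>m\<in>{1..2 * n}. f n m (2 * n) = 0) \<and>
     (\<forall>m\<in>{1..2 * n - 2}. f n m (2 * n - 1) = row_sum f (n - 1) m) \<and>
     f n (2 * n - 1) (2 * n - 1) = 0 \<and> f n (2 * n) (2 * n - 1) = 0 \<and>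
     (\<forall>k\<in>{1..2 * n - 2}. f n (2 * n) k = row_sum f (n - 1) k) \<and>
     f n (2 * n) (2 * n - 1) = 0 \<and> f n (2 * n) (2 * n) = 0 \<and>
     (\<forall>k\<in>{1..2 * n - 2}. f n (2 * n - 1) k = row_sum f (n - 1) k + col_sum f (n - 1) k) \<and>
     f n (2 * n - 1) (2 * n - 1) = 0 \<and> f n (2 * n - 1) (2 * n) = 0"

definition delta_sequence :: "(nat \<Rightarrow> nat \<Rightarrow> nat \<Rightarrow> nat) \<Rightarrow> bool" where
  "delta_sequence f \<longleftrightarrow>
     (\<forall>n\<ge>1. \<forall>m k. (m, k) \<notin> {1..2 * n} \<times> {1..2 * n} \<longrightarrow> f n m k = 0) \<and>
     f 1 1 1 = 0 \<and> f 1 1 2 = 0 \<and> f 1 2 1 = 1 \<and> f 1 2 2 = 0 \<and>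
     (\<forall>n\<ge>2. delta_step f n)"

text \<open>
  The ring \<open>\<real>[[x,y,z]]\<close> is realised as \<open>\<real>[[x]][[y]][[z]]\<close>; \<open>coeff3 F a b c\<close> is the
  coefficient of \<open>x\<^sup>a y\<^sup>b z\<^sup>c\<close>.
\<close>

type_synonym fps3 = "real fps fps fps"

definition coeff3 :: "fps3 \<Rightarrow> nat \<Rightarrow> nat \<Rightarrow> nat \<Rightarrow> real" where
  "coeff3 F a b c = F $ c $ b $ a"

definition const3 :: "real \<Rightarrow> fps3" where
  "const3 r = fps_const (fps_const (fps_const r))"

definition X3 :: fps3 where "X3 = fps_const (fps_const fps_X)"
definition Y3 :: fps3 where "Y3 = fps_const fps_X"
definition Z3 :: fps3 where "Z3 = fps_X"

text \<open>
  Substitution of \<open>G\<close> into a univariate series, for \<open>G\<close> with zero constant term: then \<open>G\<^sup>i\<close>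
  has no terms of total degree below \<open>i\<close>, so the sum may be cut off at \<open>a + b + c\<close>. (The
  library's \<^const>\<open>fps_compose\<close> would require that every term of \<open>G\<close> involves \<open>z\<close>.)
\<close>

definition subst3 :: "real fps \<Rightarrow> fps3 \<Rightarrow> fps3" where
  "subst3 F G = Abs_fps (\<lambda>c. Abs_fps (\<lambda>b. Abs_fps (\<lambda>a.
     \<Sum>i\<le>a + b + c. F $ i * coeff3 (G ^ i) a b c)))"

definition sin3 :: "fps3 \<Rightarrow> fps3" where "sin3 = subst3 (fps_sin 1)"
definition cos3 :: "fps3 \<Rightarrow> fps3" where "cos3 = subst3 (fps_cos 1)"

text \<open>
  The family \<open>(t n)\<close>, \<open>n \<in> A\<close>, is summable in \<open>\<real>[[x,y,z]]\<close> with sum \<open>S\<close>: every monomial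
  occurs in only finitely many \<open>t n\<close>. (The library topology on \<open>\<real>[[x]][[y]][[z]]\<close> is the
  \<open>z\<close>-adic one, which is too fine for this.)
\<close>

definition formal_sum3 :: "(nat \<Rightarrow> fps3) \<Rightarrow> nat set \<Rightarrow> fps3 \<Rightarrow> bool" where
  "formal_sum3 t A S \<longleftrightarrow>
     (\<forall>a b c. finite {n \<in> A. coeff3 (t n) a b c \<noteq> 0} \<and>
        (\<Sum>n | n \<in> A \<and> coeff3 (t n) a b c \<noteq> 0. coeff3 (t n) a b c) = coeff3 S a b c)"

text \<open>
  The two facts below confirm that the library division on \<^typ>\<open>fps3\<close> is genuine division by
  units, and that it is used on one.
\<close>

lemma fps3_divide_mult:
  fixes F G :: fps3
  assumes "coeff3 G 0 0 0 \<noteq> 0"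
  shows "F / G * G = F"
proof -
  have "inverse (G $ 0 $ 0) * G $ 0 $ 0 = 1"
    using assms by (intro inverse_mult_eq_1) (simp add: coeff3_def)
  then have "inverse (G $ 0) * G $ 0 = 1"
    by (metis fps_inverse_def fps_left_inverse' mult.commute)
  then have *: "inverse G * G = 1"
    by (metis fps_inverse_def fps_left_inverse' mult.commute)
  have "subdegree G = 0"
    using assms by (intro subdegreeI) (auto simp: coeff3_def)
  then have "F / G = F * inverse G"
    by (simp add: fps_divide_def)
  with * show ?thesis by (simp add: mult.assoc)
qed

lemma coeff3_cos3_0: "coeff3 (2 * cos3 G ^ 2) 0 0 0 = 2"
  by (simp add: coeff3_def cos3_def subst3_def fps_cos_def power2_eq_square numeral_fps_const)

end

theory Submission
  imports Defs
begin

text \<open>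
  Let \<open>U(x,y,z)\<close> and \<open>L(x,y,z)\<close> be the exponential generating functions of the entries above and
  below the diagonal; in \<open>L\<close> the entry \<open>f\<^sub>n(m,k)\<close>, \<open>k < m\<close>, belongs to the monomial
  \<open>x\<^bsup>2n-m\<^esup> y\<^bsup>m-k-1\<^esup> z\<^bsup>k-1\<^esup>\<close>. The finite difference equations say that
  \<open>(\<partial>/\<partial>x - \<partial>/\<partial>y)\<^sup>2\<close> acts on both as multiplication by \<open>-2\<close>, so \<open>M\<^sub>n\<close> is determined by \<open>M\<^sub>n\<^sub>-\<^sub>1\<close>
  and the boundary data, which are row and column sums of \<open>M\<^sub>n\<^sub>-\<^sub>1\<close>. It therefore suffices to guess
  \<open>U\<close> and \<open>L\<close> and to check the boundary conditions. The guess is symmetric in \<open>x\<close> and \<open>z\<close>, so it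
  also satisfies the equation for \<open>(\<partial>/\<partial>z - \<partial>/\<partial>y)\<^sup>2\<close>; thus row and column sums telescope to boundary
  values, and the conditions become identities between trigonometric series in two variables that
  follow from the addition theorems.
\<close>

section \<open>Coefficientwise maps and the substitution of a sum of two variables\<close>

definition map_coeffs :: "('a::zero \<Rightarrow> 'b::zero) \<Rightarrow> 'a fps \<Rightarrow> 'b fps" where
  "map_coeffs h F = Abs_fps (\<lambda>n. h (F $ n))"

lemma map_coeffs_nth [simp]: "map_coeffs h F $ n = h (F $ n)"
  by (simp add: map_coeffs_def)

lemma additive_map_coeffs:
  fixes h :: "'a::ab_group_add \<Rightarrow> 'b::ab_group_add"
  assumes "additive h"
  shows "additive (map_coeffs h)"
  by standard (simp add: fps_eq_iff additive.add [OF assms])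

lemma map_coeffs_mult:
  fixes h :: "'a::comm_ring_1 \<Rightarrow> 'b::comm_ring_1"
  assumes "additive h" "\<And>a b. h (a * b) = h a * h b"
  shows "map_coeffs h (F * G) = map_coeffs h F * map_coeffs h G"
  by (simp add: fps_eq_iff fps_mult_nth additive.sum [OF assms(1)] assms(2))

lemma map_coeffs_derivation:
  fixes d :: "'a::comm_ring_1 \<Rightarrow> 'a"
  assumes "additive d" "\<And>a b. d (a * b) = d a * b + a * d b"
  shows "map_coeffs d (F * G) = map_coeffs d F * G + F * map_coeffs d G"
  by (simp add: fps_eq_iff fps_mult_nth additive.sum [OF assms(1)] assms(2) sum.distrib)

lemma additive_nth_0: "additive (\<lambda>F :: 'a::ab_group_add fps. F $ 0)"
  by standard simp

lemma additive_fps_deriv: "additive (fps_deriv :: 'a::comm_ring_1 fps \<Rightarrow> _)"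
  by standard simp

lemma fps_deriv_Leibniz: "fps_deriv (F * G) = fps_deriv F * G + F * fps_deriv (G :: 'a::comm_ring_1 fps)"
  by (simp add: algebra_simps)

text \<open>\<open>fps_split F\<close> is \<open>F(u + v)\<close>, with \<open>u\<close> the inner and \<open>v\<close> the outer variable.\<close>

definition fps_split :: "'a::comm_ring_1 fps \<Rightarrow> 'a fps fps" where
  "fps_split F = Abs_fps (\<lambda>j. Abs_fps (\<lambda>i. of_nat ((i + j) choose i) * F $ (i + j)))"

lemma fps_split_nth [simp]: "fps_split F $ j $ i = of_nat ((i + j) choose i) * F $ (i + j)"
  by (simp add: fps_split_def)

lemma fps_split_add: "fps_split (F + G) = fps_split F + fps_split G"
  by (simp add: fps_eq_iff algebra_simps)

lemma fps_split_1 [simp]: "fps_split 1 = 1"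
  by (auto simp: fps_eq_iff fps_one_nth)

text \<open>Vandermonde convolution of the binomials. Together with \<open>fps_split_add\<close>
  this makes substitution of a sum a ring homomorphism.\<close>

lemma fps_split_mult: "fps_split (F * G) = fps_split F * fps_split G"
proof (intro fps_ext)
  fix i j
  \<comment> \<open>\<open>t l a\<close> is the part in which \<open>F\<close> supplies total degree
    \<open>l\<close>, of which \<open>a\<close> falls to the inner variable.\<close>
  define t where "t l a = (of_nat (l choose a) * of_nat ((i + j - l) choose (i - a)) :: 'a) * (F $ l * G $ (i + j - l))" for l a
  have inner: "(\<Sum>l\<le>i + j. t l a) = (\<Sum>b\<le>j. t (a + b) a)" if "a \<le> i" for a
  proof -
    have "(\<Sum>l\<le>i + j. t l a) = (\<Sum>l\<in>{a..a + j}. t l a)"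
    proof (rule sum.mono_neutral_right)
      show "\<forall>l\<in>{..i + j} - {a..a + j}. t l a = 0"
      proof
        fix l assume "l \<in> {..i + j} - {a..a + j}"
        \<comment> \<open>Outside the range one binomial in \<open>t\<close> has a lower index
          exceeding its upper one and vanishes.\<close>
        then have "l < a \<or> i + j - l < i - a"
          using that by auto
        then show "t l a = 0"
          by (auto simp: t_def binomial_eq_0)
      qed
    qed (use that in auto)
    also have "\<dots> = (\<Sum>b\<le>j. t (a + b) a)"
      by (rule sum.reindex_bij_witness [of _ "\<lambda>b. a + b" "\<lambda>l. l - a"]) auto
    finally show ?thesis .
  qed
  have "fps_split (F * G) $ j $ i =
      (\<Sum>l\<le>i + j. of_nat ((l + (i + j - l)) choose i) * (F $ l * G $ (i + j - l)))"
    by (simp add: fps_mult_nth sum_distrib_left atLeast0AtMost)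
  also have "\<dots> = (\<Sum>l\<le>i + j. \<Sum>a\<le>i. t l a)"
    unfolding vandermonde [symmetric] t_def by (simp add: sum_distrib_right)
  also have "\<dots> = (\<Sum>a\<le>i. \<Sum>l\<le>i + j. t l a)"
    by (rule sum.swap)
  also have "\<dots> = (\<Sum>a\<le>i. \<Sum>b\<le>j. t (a + b) a)"
    by (simp add: inner)
  also have "\<dots> = (\<Sum>b\<le>j. \<Sum>a\<le>i. t (a + b) a)"
    by (rule sum.swap)
  also have "\<dots> = (fps_split F * fps_split G) $ j $ i"
  proof -
    have "t (a + b) a = fps_split F $ b $ a * fps_split G $ (j - b) $ (i - a)"
      if "a \<le> i" "b \<le> j" for a b
    proof -
      have "i + j - (a + b) = i - a + (j - b)"
        using that by simp
      then show ?thesis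
        by (simp add: t_def algebra_simps)
    qed
    then show ?thesis
      by (simp add: fps_mult_nth fps_sum_nth atLeast0AtMost)
  qed
  finally show "fps_split (F * G) $ j $ i = (fps_split F * fps_split G) $ j $ i" .
qed

lemma Suc_times_binomial_split:
  "of_nat (Suc j) * (of_nat ((i + Suc j) choose i) * x) =
   of_nat ((i + j) choose i) * (of_nat (Suc (i + j)) * (x :: 'a::comm_ring_1))"
proof -
  have "Suc j * ((i + Suc j) choose i) = ((i + j) choose i) * Suc (i + j)"
    using Suc_times_binomial_eq [of "i + j" j] binomial_symmetric [of i "i + j"]
      binomial_symmetric [of i "i + Suc j"] by (simp add: algebra_simps)
  then show ?thesis
    by (metis mult.assoc of_nat_mult)
qed

text \<open>Chain rule in the outer variable; \<open>map_coeffs_fps_deriv_fps_split\<close> is the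
  one for the inner variable.\<close>

lemma fps_deriv_fps_split: "fps_deriv (fps_split F) = fps_split (fps_deriv F)"
proof (intro fps_ext)
  fix i j
  show "fps_deriv (fps_split F) $ j $ i = fps_split (fps_deriv F) $ j $ i"
    using Suc_times_binomial_split [of j i "F $ Suc (i + j)"]
    by (simp del: of_nat_Suc)
qed

lemma map_coeffs_fps_deriv_fps_split: "map_coeffs fps_deriv (fps_split F) = fps_split (fps_deriv F)"
proof (intro fps_ext)
  fix i j
  have "Suc i * ((Suc i + j) choose Suc i) = ((i + j) choose i) * Suc (i + j)"
    using Suc_times_binomial_eq [of "i + j" i] by (simp add: algebra_simps)
  then have "of_nat (Suc i) * (of_nat ((Suc i + j) choose Suc i) * F $ (Suc (i + j))) =
    of_nat ((i + j) choose i) * (of_nat (Suc (i + j)) * F $ Suc (i + j))"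
    by (metis mult.assoc of_nat_mult)
  then show "map_coeffs fps_deriv (fps_split F) $ j $ i = fps_split (fps_deriv F) $ j $ i"
    by (simp del: of_nat_Suc binomial_Suc_Suc)
qed

lemma map_coeffs_fps_split:
  fixes h :: "'a::comm_ring_1 \<Rightarrow> 'b::comm_ring_1"
  assumes "\<And>n a. h (of_nat n * a) = of_nat n * h a"
  shows "map_coeffs (map_coeffs h) (fps_split F) = fps_split (map_coeffs h F)"
  by (simp add: fps_eq_iff assms)

text \<open>Addition theorems. The binomial cancels against the factorial, which leaves an identity
  between signs.\<close>

lemma fps_sin_cos_fps_split:
  fixes c :: real
  shows fps_split_fps_sin: "fps_split (fps_sin c) =
      fps_const (fps_sin c) * map_coeffs fps_const (fps_cos c)
      + fps_const (fps_cos c) * map_coeffs fps_const (fps_sin c)" (is ?sin)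
    and fps_split_fps_cos: "fps_split (fps_cos c) =
      fps_const (fps_cos c) * map_coeffs fps_const (fps_cos c)
      - fps_const (fps_sin c) * map_coeffs fps_const (fps_sin c)" (is ?cos)
proof -
  \<comment> \<open>These are sin(n pi/2) and cos(n pi/2).\<close>
  define \<sigma> \<kappa> :: "nat \<Rightarrow> real" where "\<sigma> n = (if even n then 0 else (-1) ^ ((n - 1) div 2))"
    and "\<kappa> n = (if even n then (-1) ^ (n div 2) else 0)" for n
  have add: "\<sigma> (i + j) = \<sigma> i * \<kappa> j + \<kappa> i * \<sigma> j" "\<kappa> (i + j) = \<kappa> i * \<kappa> j - \<sigma> i * \<sigma> j" for i j
    by (cases "even i"; cases "even j"; auto simp: \<sigma>_def \<kappa>_def power_add elim!: evenE oddE)+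
  have sin: "fps_sin c $ n = \<sigma> n * c ^ n / fact n" and cos: "fps_cos c $ n = \<kappa> n * c ^ n / fact n" for n
    by (simp_all add: fps_sin_def fps_cos_def \<sigma>_def \<kappa>_def)
  have binom: "real ((i + j) choose i) * x / fact (i + j) = x / (fact i * fact j)" for i j x
    by (simp add: binomial_fact field_simps)
  show ?sin ?cos
    by (intro fps_ext; simp add: sin cos binom; simp add: add power_add field_simps)+
qed

section \<open>Derivations and restrictions of power series in three variables\<close>

definition in_x :: "real fps \<Rightarrow> fps3" where "in_x A = fps_const (fps_const A)"
definition in_z :: "real fps \<Rightarrow> fps3" where "in_z B = map_coeffs (\<lambda>r. fps_const (fps_const r)) B"
text \<open>The inner splitting gives Q(x + v), the outer one replaces v by y + z; the result is Q(x
  + y + z).\<close>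

definition in_sum :: "real fps \<Rightarrow> fps3" where "in_sum Q = fps_split (fps_split Q)"

definition dx :: "fps3 \<Rightarrow> fps3" where "dx = map_coeffs (map_coeffs fps_deriv)"
definition dy :: "fps3 \<Rightarrow> fps3" where "dy = map_coeffs fps_deriv"
definition dz :: "fps3 \<Rightarrow> fps3" where "dz = fps_deriv"

text \<open>The two remaining variables keep their order, so restrictions of different variables
  live in one ring and can be compared: (y, z), (x, z) and (x, y) all become (inner, outer).\<close>

definition at_x0 :: "fps3 \<Rightarrow> real fps fps" where "at_x0 = map_coeffs (map_coeffs (\<lambda>A. A $ 0))"
definition at_y0 :: "fps3 \<Rightarrow> real fps fps" where "at_y0 = map_coeffs (\<lambda>A. A $ 0)"
definition at_z0 :: "fps3 \<Rightarrow> real fps fps" where "at_z0 = (\<lambda>A. A $ 0)"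

lemmas fps3_additive_rules = additive_map_coeffs additive_fps_deriv additive_nth_0

lemma additive_fps3:
  "additive dx" "additive dy" "additive dz" "additive at_x0" "additive at_y0" "additive at_z0"
  unfolding dx_def dy_def dz_def at_x0_def at_y0_def at_z0_def
  by (intro fps3_additive_rules)+

lemma dx_mult: "dx (F * G) = dx F * G + F * dx G"
  unfolding dx_def by (intro map_coeffs_derivation fps3_additive_rules fps_deriv_Leibniz)

lemma dy_mult: "dy (F * G) = dy F * G + F * dy G"
  unfolding dy_def by (intro map_coeffs_derivation fps3_additive_rules fps_deriv_Leibniz)

lemma dz_mult: "dz (F * G) = dz F * G + F * dz G"
  unfolding dz_def by (rule fps_deriv_Leibniz)

lemma at_x0_mult: "at_x0 (F * G) = at_x0 F * at_x0 G"
  unfolding at_x0_def by (intro map_coeffs_mult fps3_additive_rules fps_mult_nth_0)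

lemma at_y0_mult: "at_y0 (F * G) = at_y0 F * at_y0 G"
  unfolding at_y0_def by (intro map_coeffs_mult fps3_additive_rules fps_mult_nth_0)

lemma at_z0_mult: "at_z0 (F * G) = at_z0 F * at_z0 G"
  unfolding at_z0_def by (rule fps_mult_nth_0)

lemma in_sum_mult: "in_sum (F * G) = in_sum F * in_sum G"
  by (simp add: in_sum_def fps_split_mult)

lemma in_sum_1 [simp]: "in_sum 1 = 1"
  by (simp add: in_sum_def)


lemma fps_deriv_of_nat_mult: "fps_deriv (of_nat n * F) = of_nat n * fps_deriv (F :: 'a::comm_ring_1 fps)"
  by (simp flip: fps_of_nat)

lemma dx_generators:
  "dx (in_x A) = in_x (fps_deriv A)" "dx (in_z B) = 0" "dx (in_sum Q) = in_sum (fps_deriv Q)"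
proof -
  show "dx (in_x A) = in_x (fps_deriv A)" "dx (in_z B) = 0"
    by (simp_all add: dx_def in_x_def in_z_def fps_eq_iff)
  show "dx (in_sum Q) = in_sum (fps_deriv Q)"
    unfolding dx_def in_sum_def
    by (subst map_coeffs_fps_split) (simp_all only: fps_deriv_of_nat_mult map_coeffs_fps_deriv_fps_split)
qed

lemma dy_generators: "dy (in_x A) = 0" "dy (in_z B) = 0" "dy (in_sum Q) = in_sum (fps_deriv Q)"
proof -
  show "dy (in_x A) = 0" "dy (in_z B) = 0"
    by (simp_all add: dy_def in_x_def in_z_def fps_eq_iff)
  show "dy (in_sum Q) = in_sum (fps_deriv Q)"
    by (simp add: dy_def in_sum_def map_coeffs_fps_deriv_fps_split fps_deriv_fps_split)
qed

lemma dz_generators: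
  "dz (in_x A) = 0" "dz (in_z B) = in_z (fps_deriv B)" "dz (in_sum Q) = in_sum (fps_deriv Q)"
proof -
  show "dz (in_x A) = 0" 
    by (simp add: dz_def in_x_def)
  show "dz (in_z B) = in_z (fps_deriv B)"
    by (auto simp add: dz_def in_z_def fps_eq_iff simp flip: fps_of_nat)
  show "dz (in_sum Q) = in_sum (fps_deriv Q)"
    by (simp add: dz_def in_sum_def fps_deriv_fps_split)
qed

lemma at_x0_generators:
  "at_x0 (in_x A) = fps_const (fps_const (A $ 0))"
  "at_x0 (in_z B) = map_coeffs fps_const B"
  "at_x0 (in_sum Q) = fps_split Q"
  by (auto simp: at_x0_def in_x_def in_z_def in_sum_def fps_eq_iff simp flip: fps_of_nat)

lemma at_y0_generators:
  "at_y0 (in_x A) = fps_const A"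
  "at_y0 (in_z B) = map_coeffs fps_const B"
  "at_y0 (in_sum Q) = fps_split Q"
  by (auto simp: at_y0_def in_x_def in_z_def in_sum_def fps_eq_iff)

lemma at_z0_generators:
  "at_z0 (in_x A) = fps_const A"
  "at_z0 (in_z B) = fps_const (fps_const (B $ 0))"
  "at_z0 (in_sum Q) = fps_split Q"
  by (auto simp: at_z0_def in_x_def in_z_def in_sum_def fps_eq_iff)

text \<open>
  The operators \<open>\<partial>/\<partial>x - \<partial>/\<partial>y\<close> and \<open>\<partial>/\<partial>z - \<partial>/\<partial>y\<close> annihilate every series in \<open>x + y + z\<close>, so on
  \<open>A(x) B(z) Q(x + y + z)\<close> they differentiate \<open>A\<close> or \<open>B\<close> alone.
\<close>

definition prod3 :: "real fps \<Rightarrow> real fps \<Rightarrow> real fps \<Rightarrow> fps3" where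
  "prod3 A B Q = in_x A * in_z B * in_sum Q"

definition Dxy :: "fps3 \<Rightarrow> fps3" where "Dxy F = dx F - dy F"
definition Dzy :: "fps3 \<Rightarrow> fps3" where "Dzy F = dz F - dy F"

lemma additive_D: "additive Dxy" "additive Dzy"
  by (standard; simp add: Dxy_def Dzy_def additive.add [OF additive_fps3(1)]
    additive.add [OF additive_fps3(2)] additive.add [OF additive_fps3(3)])+

lemma Dxy_prod3: "Dxy (prod3 A B Q) = prod3 (fps_deriv A) B Q"
  by (simp add: Dxy_def prod3_def dx_mult dy_mult dx_generators dy_generators algebra_simps)

lemma Dzy_prod3: "Dzy (prod3 A B Q) = prod3 A (fps_deriv B) Q"
  by (simp add: Dzy_def prod3_def dz_mult dy_mult dz_generators dy_generators algebra_simps)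

lemma prod3_const:
  "prod3 (fps_const r * A) B Q = const3 r * prod3 A B Q"
  "prod3 A (fps_const r * B) Q = const3 r * prod3 A B Q"
proof -
  show "prod3 (fps_const r * A) B Q = const3 r * prod3 A B Q"
    by (simp add: prod3_def in_x_def const3_def mult.assoc flip: fps_const_mult)
  have "in_z (fps_const r * B) = const3 r * in_z B"
    by (simp add: in_z_def const3_def fps_eq_iff)
  then show "prod3 A (fps_const r * B) Q = const3 r * prod3 A B Q"
    by (simp add: prod3_def algebra_simps)
qed

lemma at_0_const3:
  "at_x0 (const3 r) = fps_const (fps_const r)"
  "at_y0 (const3 r) = fps_const (fps_const r)"
  "at_z0 (const3 r) = fps_const (fps_const r)"
  by (auto simp: at_x0_def at_y0_def at_z0_def const3_def fps_eq_iff)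

lemma at_0_prod3:
  "at_x0 (prod3 A B Q) = fps_const (fps_const (A $ 0)) * map_coeffs fps_const B * fps_split Q"
  "at_y0 (prod3 A B Q) = fps_const A * map_coeffs fps_const B * fps_split Q"
  "at_z0 (prod3 A B Q) = fps_const A * fps_const (fps_const (B $ 0)) * fps_split Q"
  by (simp_all add: prod3_def at_x0_mult at_y0_mult at_z0_mult at_x0_generators at_y0_generators
      at_z0_generators)

lemma coeff3_in_sum:
  "coeff3 (in_sum Q) a b c = real ((b + c) choose b) * real ((a + b + c) choose a) * Q $ (a + b + c)"
  by (simp add: coeff3_def in_sum_def algebra_simps flip: fps_of_nat)

lemma coeff3_prod3:
  "coeff3 (prod3 A B Q) a b c =
   (\<Sum>j\<le>c. \<Sum>i\<le>a. A $ i * B $ j * coeff3 (in_sum Q) (a - i) b (c - j))"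
proof -
  have "prod3 A B Q $ c $ b = A * (\<Sum>j\<le>c. fps_const (B $ j) * in_sum Q $ (c - j) $ b)"
    by (simp add: prod3_def in_x_def mult.assoc)
      (simp add: in_z_def fps_mult_nth [of "map_coeffs _ B"] fps_sum_nth atLeast0AtMost)
  also have "\<dots> = (\<Sum>j\<le>c. fps_const (B $ j) * (A * in_sum Q $ (c - j) $ b))"
    by (simp add: sum_distrib_left ac_simps)
  finally show ?thesis
    by (simp add: coeff3_def fps_sum_nth)
      (simp add: fps_mult_nth atLeast0AtMost sum_distrib_left ac_simps)
qed

text \<open>Exchanging x and z exchanges \<open>A\<close> and \<open>B\<close> and fixes x + y +
  z.\<close>

lemma coeff3_prod3_swap: "coeff3 (prod3 A B Q) a b c = coeff3 (prod3 B A Q) c b a"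
proof -
  have in_sum: "coeff3 (in_sum Q) a b c = coeff3 (in_sum Q) c b a" for a b c
  proof -
    have "real ((b + c) choose b) * real ((a + b + c) choose a) =
      real ((b + a) choose b) * real ((c + b + a) choose c)"
      by (simp add: binomial_fact algebra_simps)
    then show ?thesis
      by (simp add: coeff3_in_sum ac_simps)
  qed
  show ?thesis
    unfolding coeff3_prod3
    by (subst sum.swap, subst in_sum) (simp add: mult.commute)
qed

section \<open>Normalised coefficients, on which derivatives act as index shifts, and telescoping
  sums\<close>

definition egf3 :: "fps3 \<Rightarrow> nat \<Rightarrow> nat \<Rightarrow> nat \<Rightarrow> real" where
  "egf3 F a b c = coeff3 F a b c * fact a * fact b * fact c"

lemma egf3_diff: "egf3 (F - G) a b c = egf3 F a b c - egf3 G a b c"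
  by (simp add: egf3_def coeff3_def algebra_simps)

lemma egf3_const: "egf3 (const3 r * F) a b c = r * egf3 F a b c"
  by (simp add: egf3_def coeff3_def const3_def)

lemma egf3_deriv:
  "egf3 (dx F) a b c = egf3 F (Suc a) b c"
  "egf3 (dy F) a b c = egf3 F a (Suc b) c"
  "egf3 (dz F) a b c = egf3 F a b (Suc c)"
  by (simp_all add: egf3_def coeff3_def dx_def dy_def dz_def algebra_simps flip: fps_of_nat)

lemma egf3_D:
  "egf3 (Dxy F) a b c = egf3 F (Suc a) b c - egf3 F a (Suc b) c"
  "egf3 (Dzy F) a b c = egf3 F a b (Suc c) - egf3 F a (Suc b) c"
  by (simp_all add: Dxy_def Dzy_def egf3_diff egf3_deriv)

lemma egf3_at_0:
  "egf3 F 0 p q = at_x0 F $ q $ p * fact p * fact q"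
  "egf3 F p 0 q = at_y0 F $ q $ p * fact p * fact q"
  "egf3 F p q 0 = at_z0 F $ q $ p * fact p * fact q"
  by (simp_all add: egf3_def coeff3_def at_x0_def at_y0_def at_z0_def)

lemma sum_second_difference:
  fixes p :: "nat \<Rightarrow> real"
  shows "(\<Sum>i<n. p i - 2 * p (Suc i) + p (Suc (Suc i))) = (p (Suc n) - p n) - (p 1 - p 0)"
  by (induction n) simp_all

text \<open>By the differential equation each summand is, up to the factor -2, a second difference,
  so the sum telescopes.\<close>

lemma sum_egf3_xy:
  assumes "Dxy (Dxy F) = const3 (-2) * F"
  shows "2 * (\<Sum>i<n. egf3 F i (n - 1 - i) c) = egf3 (Dxy F) 0 n c - egf3 (Dxy F) n 0 c"
proof -
  \<comment> \<open>The line with index sum n + 1: second differences along it land on the index sum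
    n - 1 of the summands.\<close>
  define p where "p i = egf3 F i (Suc n - i) c" for i
  have "- 2 * egf3 F i (n - 1 - i) c = p i - 2 * p (Suc i) + p (Suc (Suc i))" if "i < n" for i
  proof -
    have "- 2 * egf3 F i (n - 1 - i) c = egf3 (Dxy (Dxy F)) i (n - 1 - i) c"
      by (simp only: assms egf3_const)
    moreover have "Suc n - i = Suc (Suc (n - 1 - i))" "Suc n - Suc i = Suc (n - 1 - i)" 
       "Suc n - Suc (Suc i) = n - 1 - i"
      using that by auto
    ultimately show ?thesis
      by (simp only: egf3_D p_def)
  qed
  then have "- 2 * (\<Sum>i<n. egf3 F i (n - 1 - i) c) = (\<Sum>i<n. p i - 2 * p (Suc i) + p (Suc (Suc i)))"
    by (simp add: sum_distrib_left)
  then show ?thesis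
    unfolding sum_second_difference by (simp add: egf3_D p_def)
qed

lemma sum_egf3_zy:
  assumes "Dzy (Dzy F) = const3 (-2) * F"
  shows "2 * (\<Sum>j<n. egf3 F a (n - 1 - j) j) = egf3 (Dzy F) a n 0 - egf3 (Dzy F) a 0 n"
proof -
  define p where "p j = egf3 F a (Suc n - j) j" for j
  have "- 2 * egf3 F a (n - 1 - j) j = p j - 2 * p (Suc j) + p (Suc (Suc j))" if "j < n" for j
  proof -
    have "- 2 * egf3 F a (n - 1 - j) j = egf3 (Dzy (Dzy F)) a (n - 1 - j) j"
      by (simp only: assms egf3_const)
    moreover have "Suc n - j = Suc (Suc (n - 1 - j))" "Suc n - Suc j = Suc (n - 1 - j)" 
       "Suc n - Suc (Suc j) = n - 1 - j"
      using that by auto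
    ultimately show ?thesis
      by (simp only: egf3_D p_def)
  qed
  then have "- 2 * (\<Sum>j<n. egf3 F a (n - 1 - j) j) = (\<Sum>j<n. p j - 2 * p (Suc j) + p (Suc (Suc j)))"
    by (simp add: sum_distrib_left)
  then show ?thesis
    unfolding sum_second_difference by (simp add: egf3_D p_def)
qed

text \<open>This matches conditions (b) and (c), solved for the entry farthest from the last column
  or row.\<close>

lemma egf3_recurrence:
  assumes "Dxy (Dxy F) = const3 (-2) * F"
  shows "egf3 F (Suc (Suc a)) b c =
    2 * egf3 F (Suc a) (Suc b) c - egf3 F a (Suc (Suc b)) c - 2 * egf3 F a b c"
proof -
  have "egf3 (Dxy (Dxy F)) a b c = - 2 * egf3 F a b c"
    by (simp only: assms egf3_const)
  then show ?thesis
    by (simp add: egf3_D)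
qed

section \<open>The two generating functions\<close>

abbreviation S :: "real fps" where "S \<equiv> fps_sin (sqrt 2)"
abbreviation C :: "real fps" where "C \<equiv> fps_cos (sqrt 2)"

text \<open>Since \<open>2 cos\<^sup>2 (w/\<surd>2) = 1 + cos (\<surd>2 w)\<close>, \<open>T\<close> is \<open>1 / (2 cos\<^sup>2 (w/\<surd>2))\<close> and \<open>S * T\<close> is \<open>tan (w/\<surd>2)\<close>.\<close>

definition T :: "real fps" where "T = inverse (1 + C)"

lemma T_mult: "T * (1 + C) = 1"
  unfolding T_def by (rule inverse_mult_eq_1) simp

lemma sin_cos_squares: "C * C + S * S = 1"
  using fps_sin_cos_sum_of_squares [of "sqrt 2"] by (simp add: power2_eq_square)

lemma deriv_S: "fps_deriv S = fps_const (sqrt 2) * C"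
  and deriv_C: "fps_deriv C = fps_const (- sqrt 2) * S"
  by (rule fps_sin_deriv fps_cos_deriv)+

text \<open>The derivative of tan (w/\<surd>2), w being the variable.\<close>

lemma deriv_ST: "fps_deriv (S * T) = fps_const (sqrt 2) * T"
proof -
  define r where "r = fps_const (sqrt 2)"
  have "fps_deriv T * (1 + C) + T * fps_deriv C = 0"
    using arg_cong [OF T_mult, of fps_deriv] by (simp add: algebra_simps)
  then have 1: "fps_deriv T * (1 + C) = r * T * S"
    by (simp add: deriv_C r_def algebra_simps flip: fps_const_neg)
  \<comment> \<open>Both sides are compared after multiplication by the unit
    \<open>1 + C\<close>.\<close>
  have "fps_deriv (S * T) * (1 + C) = r * C * (T * (1 + C)) + S * (fps_deriv T * (1 + C))"
    by (simp add: deriv_S algebra_simps flip: r_def)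
  also have "\<dots> = r * (C + T * (S * S))"
    by (simp only: 1 T_mult) (simp add: algebra_simps)
  also have "\<dots> = r * T * (1 + C)"
    using T_mult sin_cos_squares by algebra
  finally show ?thesis
    using T_mult by (auto simp: r_def)
qed

text \<open>As cos is even, all other terms in the n-th coefficient of
  \<open>T * (1 + C) = 1\<close> vanish for odd n.\<close>

lemma even_T: "odd n \<Longrightarrow> T $ n = 0"
proof (induction n rule: less_induct)
  case (less n)
  have "(T * (1 + C)) $ n = 0"
    using odd_pos [OF less.prems] by (simp add: T_mult)
  then have "(\<Sum>i\<le>n. T $ i * (1 + C) $ (n - i)) = 0"
    by (simp add: fps_mult_nth atLeast0AtMost)
  moreover have "T $ i * (1 + C) $ (n - i) = 0" if "i < n" for i
  proof (cases "odd i")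
    case False
    with less.prems that have "odd (n - i)" by simp
    with that show ?thesis by (simp add: fps_cos_def)
  qed (use less.IH that in auto)
  then have "(\<Sum>i<n. T $ i * (1 + C) $ (n - i)) = 0"
    by (simp add: sum.neutral)
  ultimately show ?case
    unfolding lessThan_Suc_atMost [symmetric] sum.lessThan_Suc by simp
qed

text \<open>The right-hand side of the theorem, as \<open>quotient_eq_Ugf\<close> shows.\<close>

definition Ugf :: fps3 where "Ugf = prod3 S S T"

text \<open>\<open>Lgf\<close> is \<open>cos ((x - y + z)/\<surd>2) / cos ((x + y + z)/\<surd>2) + Ugf\<close>.\<close>

definition Lgf :: fps3 where
  "Lgf = prod3 C C 1 - prod3 S S 1 + prod3 S C (S * T) + prod3 C S (S * T) + prod3 S S T"

definition ucoef :: "nat \<Rightarrow> nat \<Rightarrow> nat \<Rightarrow> real" where "ucoef = egf3 Ugf"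
definition lcoef :: "nat \<Rightarrow> nat \<Rightarrow> nat \<Rightarrow> real" where "lcoef = egf3 Lgf"

lemmas D_simps = Dxy_prod3 Dzy_prod3 additive.add [OF additive_D(1)] additive.add [OF additive_D(2)]
  additive.diff [OF additive_D(1)] additive.diff [OF additive_D(2)]

lemma deriv2: "fps_deriv (fps_deriv S) = fps_const (-2) * S" "fps_deriv (fps_deriv C) = fps_const (-2) * C"
  by (simp_all add: deriv_S deriv_C flip: mult.assoc)

text \<open>The factors in x and in z are sines, which satisfy g'' = -2g; in \<open>Lgf\<close> they
  are sines or cosines.\<close>

lemma D_D_Ugf: "Dxy (Dxy Ugf) = const3 (-2) * Ugf" "Dzy (Dzy Ugf) = const3 (-2) * Ugf"
  by (simp_all only: Ugf_def D_simps deriv2 prod3_const)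

lemma D_D_Lgf: "Dxy (Dxy Lgf) = const3 (-2) * Lgf" "Dzy (Dzy Lgf) = const3 (-2) * Lgf"
  by (simp_all only: Lgf_def D_simps deriv2 prod3_const distrib_left right_diff_distrib)

lemma const3_minus: "const3 (- r) = - const3 r"
  by (simp add: const3_def)

lemma Dxy_Ugf: "Dxy Ugf = const3 (sqrt 2) * prod3 C S T"
  and Dzy_Ugf: "Dzy Ugf = const3 (sqrt 2) * prod3 S C T"
  by (simp_all only: Ugf_def D_simps deriv_S prod3_const)

lemma Dxy_Lgf: "Dxy Lgf = const3 (sqrt 2) *
   (- prod3 S C 1 - prod3 C S 1 + prod3 C C (S * T) - prod3 S S (S * T) + prod3 C S T)"
  and Dzy_Lgf: "Dzy Lgf = const3 (sqrt 2) *
   (- prod3 C S 1 - prod3 S C 1 - prod3 S S (S * T) + prod3 C C (S * T) + prod3 S C T)"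
  by (simp_all only: Lgf_def D_simps deriv_S deriv_C prod3_const const3_minus)
    (simp_all add: algebra_simps)

text \<open>On the matrix, swapping x and z is reflection in the antidiagonal.\<close>

lemma lcoef_swap: "lcoef a b c = lcoef c b a"
proof -
  have "coeff3 Lgf a b c = coeff3 Lgf c b a"
    using coeff3_prod3_swap [of S C "S * T" a b c] coeff3_prod3_swap [of C S "S * T" a b c]
      coeff3_prod3_swap [of S S T a b c] coeff3_prod3_swap [of S S 1 a b c]
      coeff3_prod3_swap [of C C 1 a b c]
    by (simp add: Lgf_def coeff3_def)
  then show ?thesis
    by (simp add: lcoef_def egf3_def)
qed

lemma ucoef_swap: "ucoef a b c = ucoef c b a"
  using coeff3_prod3_swap [of S S T a b c] by (simp add: ucoef_def egf3_def Ugf_def)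

lemmas at_0_simps = at_0_prod3 at_x0_mult at_y0_mult at_z0_mult at_0_const3
  additive.add [OF additive_fps3(4)] additive.add [OF additive_fps3(5)]
  additive.add [OF additive_fps3(6)] additive.diff [OF additive_fps3(4)]
  additive.diff [OF additive_fps3(5)] additive.diff [OF additive_fps3(6)]
  additive.minus [OF additive_fps3(4)] additive.minus [OF additive_fps3(5)]
  additive.minus [OF additive_fps3(6)]

lemma ucoef_0: "ucoef 0 b c = 0" "ucoef a b 0 = 0"
proof -
  show "ucoef 0 b c = 0" for b c
    by (simp add: ucoef_def egf3_at_0 Ugf_def at_0_simps)
  then show "ucoef a b 0 = 0"
    by (simp add: ucoef_swap [of a b 0])
qed

section \<open>Boundary conditions as polynomial identities between two-variable series\<close>

context
  fixes c1 s1 c2 s2 t :: "real fps fps"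
  defines "c1 \<equiv> fps_const C" and "s1 \<equiv> fps_const S"
    and "c2 \<equiv> map_coeffs fps_const C" and "s2 \<equiv> map_coeffs fps_const S"
    and "t \<equiv> fps_split T"
begin

text \<open>The first three relations generate all that \<open>algebra\<close> needs below; the last
  one expresses tan ((u + v)/\<surd>2) in these terms.\<close>

lemma trig_uv:
  "c1 * c1 + s1 * s1 = 1" "c2 * c2 + s2 * s2 = 1" "t * (1 + (c1 * c2 - s1 * s2)) = 1"
  "fps_split (S * T) = (s1 * c2 + c1 * s2) * t"
proof -
  show "c1 * c1 + s1 * s1 = 1"
    unfolding c1_def s1_def fps_const_mult fps_const_add sin_cos_squares by simp
  have "map_coeffs fps_const (F * G) = map_coeffs fps_const F * map_coeffs fps_const G"
    for F G :: "real fps"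
    by (rule map_coeffs_mult) (auto intro: additive.intro)
  moreover have "map_coeffs fps_const (F + G) = map_coeffs fps_const F + map_coeffs fps_const G"
    for F G :: "real fps"
    by (simp add: fps_eq_iff)
  moreover have "map_coeffs fps_const (1 :: real fps) = 1"
    by (simp add: fps_eq_iff)
  ultimately show "c2 * c2 + s2 * s2 = 1"
    unfolding c2_def s2_def by (metis sin_cos_squares)
  show "t * (1 + (c1 * c2 - s1 * s2)) = 1"
    using arg_cong [OF T_mult, of fps_split]
    unfolding fps_split_mult fps_split_add fps_split_fps_cos fps_split_1 c1_def s1_def c2_def s2_def t_def .
  show "fps_split (S * T) = (s1 * c2 + c1 * s2) * t"
    unfolding fps_split_mult fps_split_fps_sin c1_def s1_def c2_def s2_def t_def ..
qed

text \<open>What \<open>row_relation\<close> becomes once both partial row sums have been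
  telescoped.\<close>

lemma row_identity: "at_z0 (Dzy Lgf) - at_y0 (Dzy Lgf) = at_x0 (Dxy Ugf) + at_y0 (Dxy Ugf)"
proof -
  define r :: "real fps fps" where "r = fps_const (fps_const (sqrt 2))"
  have "at_z0 (Dzy Lgf) = r * (- s1 + c1 * ((s1 * c2 + c1 * s2) * t) + s1 * t)"
    unfolding Dzy_Lgf at_0_simps trig_uv(4)
    by (simp add: c1_def s1_def t_def r_def)
  moreover have "at_y0 (Dzy Lgf) = r * (- (c1 * s2) - s1 * c2
      + (c1 * c2 - s1 * s2) * ((s1 * c2 + c1 * s2) * t) + s1 * c2 * t)"
    unfolding Dzy_Lgf at_0_simps trig_uv(4)
    by (simp add: c1_def s1_def c2_def s2_def t_def r_def algebra_simps)
  moreover have "at_x0 (Dxy Ugf) = r * (s2 * t)" "at_y0 (Dxy Ugf) = r * (c1 * s2 * t)"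
    unfolding Dxy_Ugf at_0_simps by (simp_all add: c1_def s2_def t_def r_def)
  moreover have "- s1 + c1 * ((s1 * c2 + c1 * s2) * t) + s1 * t - (- (c1 * s2) - s1 * c2
      + (c1 * c2 - s1 * s2) * ((s1 * c2 + c1 * s2) * t) + s1 * c2 * t) = s2 * t + c1 * s2 * t"
    using trig_uv(1,2,3) by algebra
  ultimately show ?thesis
    by (metis right_diff_distrib distrib_left)
qed

text \<open>Needed for row 2n - 1: the left side gives its excess over the row sums, the right side
  the column sums.\<close>

lemma boundary_identity: "at_x0 (Dxy Lgf) = at_z0 (Dzy Ugf)"
proof -
  define r :: "real fps fps" where "r = fps_const (fps_const (sqrt 2))"
  have "at_x0 (Dxy Lgf) = r * (- s2 + c2 * ((s1 * c2 + c1 * s2) * t) + s2 * t)"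
    unfolding Dxy_Lgf at_0_simps trig_uv(4)
    by (simp add: c2_def s2_def t_def r_def)
  moreover have "at_z0 (Dzy Ugf) = r * (s1 * t)"
    unfolding Dzy_Ugf at_0_simps by (simp add: s1_def t_def r_def)
  moreover have "- s2 + c2 * ((s1 * c2 + c1 * s2) * t) + s2 * t = s1 * t"
    using trig_uv(1,2,3) by algebra
  ultimately show ?thesis
    by simp
qed

lemma at_x0_Lgf: "at_x0 Lgf = c2 + s2 * fps_split (S * T)"
  unfolding Lgf_def at_0_simps c2_def s2_def by simp

text \<open>At x = 0 the variable y enters \<open>Lgf\<close> only through the tangent, so
  \<open>deriv_ST\<close> applies.\<close>

lemma at_x0_dy_Lgf: "at_x0 (dy Lgf) = at_x0 (Dxy Ugf)"
proof -
  have [simp]: "map_coeffs fps_deriv c2 = 0" "map_coeffs fps_deriv s2 = 0"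
    by (simp_all add: fps_eq_iff c2_def s2_def)
  have "at_x0 (dy Lgf) = map_coeffs fps_deriv (at_x0 Lgf)"
    by (simp add: fps_eq_iff at_x0_def dy_def flip: fps_of_nat)
  also have "\<dots> = s2 * fps_split (fps_const (sqrt 2) * T)"
    unfolding at_x0_Lgf additive.add [OF additive_map_coeffs [OF additive_fps_deriv]]
      map_coeffs_derivation [OF additive_fps_deriv fps_deriv_Leibniz]
      map_coeffs_fps_deriv_fps_split deriv_ST by simp
  also have "fps_split (fps_const (sqrt 2) * T) = fps_const (fps_const (sqrt 2)) * t"
    by (simp add: fps_eq_iff t_def)
  finally show ?thesis
    unfolding Dxy_Ugf at_0_simps by (simp add: s2_def t_def)
qed

end

text \<open>Condition (e) for row 2n, as \<open>ucoef 1 p q\<close> will turn out to be the sum of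
  row \<open>q + 1\<close> of the preceding matrix.\<close>

lemma lcoef_0_Suc: "lcoef 0 (Suc p) q = ucoef 1 p q"
proof -
  have "lcoef 0 (Suc p) q = egf3 (dy Lgf) 0 p q"
    by (simp add: lcoef_def egf3_deriv)
  also have "\<dots> = egf3 (Dxy Ugf) 0 p q"
    by (simp add: egf3_at_0 at_x0_dy_Lgf)
  also have "\<dots> = ucoef 1 p q"
    using ucoef_0(1) [of "Suc p" q] by (simp add: egf3_D flip: ucoef_def)
  finally show ?thesis .
qed

text \<open>Condition (e) for row 2n - 1; the second summand is the column sum.\<close>

lemma lcoef_1: "lcoef 1 p q = ucoef 1 p q + ucoef 1 q p"
proof -
  have "lcoef 1 p q - lcoef 0 (Suc p) q = egf3 (Dxy Lgf) 0 p q"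
    by (simp add: lcoef_def egf3_D)
  also have "\<dots> = egf3 (Dzy Ugf) p q 0"
    by (simp add: egf3_at_0 boundary_identity)
  also have "\<dots> = ucoef 1 q p"
    using ucoef_0(2) [of p "Suc q"] ucoef_swap [of 1 q p] by (simp add: egf3_D flip: ucoef_def)
  finally show ?thesis
    by (simp add: lcoef_0_Suc)
qed

text \<open>The entry in row 2n and column 2n - 1: at x = y = 0, \<open>Lgf\<close> is cos(\<surd>2
  z) + sin(\<surd>2 z) tan(z/\<surd>2) = 1.\<close>

lemma lcoef_0_0: "lcoef 0 0 c = (if c = 0 then 1 else 0)"
proof -
  have eq: "C + S * (S * T) = 1"
    using T_mult sin_cos_squares by algebra
  have "at_x0 Lgf $ c $ 0 = (C + S * (S * T)) $ c"
    unfolding at_x0_Lgf by (simp add: fps_mult_nth [of "map_coeffs _ _"] fps_sum_nth fps_mult_nth [of S "S * T"])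
  then show ?thesis
    unfolding lcoef_def egf3_at_0(1) eq by simp
qed

text \<open>The left side is the sum of row \<open>q + 1\<close> split at the diagonal, the right
  side the entry that condition (d) puts into the next matrix.\<close>

lemma row_relation:
  "(\<Sum>j<q. lcoef p (q - 1 - j) j) + (\<Sum>i<p. ucoef i (p - 1 - i) q) = ucoef 1 p q"
proof -
  have "2 * (\<Sum>j<q. lcoef p (q - 1 - j) j) = egf3 (Dzy Lgf) p q 0 - egf3 (Dzy Lgf) p 0 q"
    unfolding lcoef_def by (rule sum_egf3_zy [OF D_D_Lgf(2)])
  moreover have "2 * (\<Sum>i<p. ucoef i (p - 1 - i) q) = egf3 (Dxy Ugf) 0 p q - egf3 (Dxy Ugf) p 0 q"
    unfolding ucoef_def by (rule sum_egf3_xy [OF D_D_Ugf(1)])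
  moreover have "egf3 (Dzy Lgf) p q 0 - egf3 (Dzy Lgf) p 0 q = egf3 (Dxy Ugf) 0 p q + egf3 (Dxy Ugf) p 0 q"
    using arg_cong [OF row_identity, of "\<lambda>F. F $ q $ p * fact p * fact q"]
    by (simp add: egf3_at_0 algebra_simps)
  moreover have "egf3 (Dxy Ugf) 0 p q = ucoef 1 p q"
    using ucoef_0(1) [of "Suc p" q] by (simp add: egf3_D flip: ucoef_def)
  ultimately show ?thesis
    by simp
qed

text \<open>Reflection in the antidiagonal turns column \<open>q + 1\<close> into row
  \<open>p + 1\<close>.\<close>

lemma col_relation:
  "(\<Sum>j<q. ucoef p (q - 1 - j) j) + (\<Sum>i<p. lcoef i (p - 1 - i) q) = ucoef 1 q p"
  using row_relation [of q p] by (simp add: ucoef_swap [of p] lcoef_swap [of _ _ q])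

section \<open>The Delta sequence\<close>

text \<open>The diagonal entry drops out, and the second part is reversed so that \<open>i\<close>
  becomes the exponent of x.\<close>

lemma sum_split_at:
  fixes g :: "nat \<Rightarrow> real"
  assumes "g (q + 1) = 0"
  shows "(\<Sum>k = 1..p + q + 1. g k) = (\<Sum>j<q. g (j + 1)) + (\<Sum>i<p. g (p - 1 - i + q + 2))"
proof -
  have "(\<Sum>k = 1..p + q + 1. g k) = (\<Sum>j<q. g (j + 1)) + (\<Sum>i<p. g (i + q + 2))"
    using assms
  proof (induction p)
    case 0
    have "(\<Sum>k = 1..q. g k) = (\<Sum>j<q. g (j + 1))"
      using sum.atLeast1_atMost_eq [of g q] by simp
    then show ?case
      using 0 by simp
  qed simp
  then show ?thesis
    using sum.nat_diff_reindex [of "\<lambda>i. g (i + q + 2)" p] by simp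
qed

text \<open>The triples \<open>(a, b, c)\<close> run through all positions off the diagonal: for m <
  k they are (2n - k, k - m - 1, m - 1), and below it m and k trade places.\<close>

definition closed_form :: "(nat \<Rightarrow> nat \<Rightarrow> nat \<Rightarrow> nat) \<Rightarrow> nat \<Rightarrow> bool" where
  "closed_form f n \<longleftrightarrow> (\<forall>m\<in>{1..2 * n}. f n m m = 0) \<and>
     (\<forall>a b c. a + b + c + 2 = 2 * n \<longrightarrow>
        real (f n (c + 1) (b + c + 2)) = ucoef a b c \<and>
        real (f n (b + c + 2) (c + 1)) = lcoef a b c)"

lemma row_sum_closed_form:
  assumes "closed_form f n" "p + q + 1 = 2 * n"
  shows "real (row_sum f n (q + 1)) = ucoef 1 p q"
proof -
  have "real (row_sum f n (q + 1)) = (\<Sum>k = 1..p + q + 1. real (f n (q + 1) k))"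
    using assms(2) by (simp add: row_sum_def)
  also have "\<dots> = (\<Sum>j<q. real (f n (q + 1) (j + 1)))
      + (\<Sum>i<p. real (f n (q + 1) (p - 1 - i + q + 2)))"
    by (rule sum_split_at) (use assms in \<open>auto simp: closed_form_def\<close>)
  also have "\<dots> = (\<Sum>j<q. lcoef p (q - 1 - j) j) + (\<Sum>i<p. ucoef i (p - 1 - i) q)"
  proof (intro arg_cong2 [where f = "(+)"] sum.cong refl)
    fix j assume "j \<in> {..<q}"
    then have "p + (q - 1 - j) + j + 2 = 2 * n" "q - 1 - j + j + 2 = q + 1"
      using assms(2) by auto
    then show "real (f n (q + 1) (j + 1)) = lcoef p (q - 1 - j) j"
      using assms(1) unfolding closed_form_def by metis
  next
    fix i assume "i \<in> {..<p}"
    then have "i + (p - 1 - i) + q + 2 = 2 * n"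
      using assms(2) by auto
    then show "real (f n (q + 1) (p - 1 - i + q + 2)) = ucoef i (p - 1 - i) q"
      using assms(1) unfolding closed_form_def by metis
  qed
  finally show ?thesis
    by (simp only: row_relation)
qed

lemma col_sum_closed_form:
  assumes "closed_form f n" "p + q + 1 = 2 * n"
  shows "real (col_sum f n (q + 1)) = ucoef 1 q p"
proof -
  have "real (col_sum f n (q + 1)) = (\<Sum>m = 1..p + q + 1. real (f n m (q + 1)))"
    using assms(2) by (simp add: col_sum_def)
  also have "\<dots> = (\<Sum>j<q. real (f n (j + 1) (q + 1)))
      + (\<Sum>i<p. real (f n (p - 1 - i + q + 2) (q + 1)))"
    by (rule sum_split_at) (use assms in \<open>auto simp: closed_form_def\<close>)
  also have "\<dots> = (\<Sum>j<q. ucoef p (q - 1 - j) j) + (\<Sum>i<p. lcoef i (p - 1 - i) q)"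
  proof (intro arg_cong2 [where f = "(+)"] sum.cong refl)
    fix j assume "j \<in> {..<q}"
    then have "p + (q - 1 - j) + j + 2 = 2 * n" "q - 1 - j + j + 2 = q + 1"
      using assms(2) by auto
    then show "real (f n (j + 1) (q + 1)) = ucoef p (q - 1 - j) j"
      using assms(1) unfolding closed_form_def by metis
  next
    fix i assume "i \<in> {..<p}"
    then have "i + (p - 1 - i) + q + 2 = 2 * n"
      using assms(2) by auto
    then show "real (f n (p - 1 - i + q + 2) (q + 1)) = lcoef i (p - 1 - i) q"
      using assms(1) unfolding closed_form_def by metis
  qed
  finally show ?thesis
    by (simp only: col_relation)
qed

text \<open>Induction on \<open>a\<close>, the distance from the last column (above the diagonal) or
  last row (below it). The cases 0 and 1 are the boundary data; the difference equations and the
  preceding matrix give the others.\<close>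

lemma closed_form_step:
  assumes step: "delta_step f (Suc n)" and prev: "closed_form f n" and "n \<ge> 1"
  shows "closed_form f (Suc n)"
proof -
  let ?n = "Suc n"
  have upper_rec: "real (f ?n m k) = 2 * real (f ?n m (k + 1)) - real (f ?n m (k + 2)) - 2 * real (f n m k)"
    if "1 \<le> m" "m < k" "k \<le> 2 * n" for m k
  proof -
    have "int (f ?n m (k + 2)) - 2 * int (f ?n m (k + 1)) + int (f ?n m k) + 2 * int (f n m k) = 0"
      using step that unfolding delta_step_def U1_def by auto
    then show ?thesis by linarith
  qed
  have lower_rec: "real (f ?n m k) = 2 * real (f ?n (m + 1) k) - real (f ?n (m + 2) k) - 2 * real (f n m k)"
    if "1 \<le> k" "k < m" "m \<le> 2 * n" for m k
  proof -
    have "int (f ?n (m + 2) k) - 2 * int (f ?n (m + 1) k) + int (f ?n m k) + 2 * int (f n m k) = 0"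
      using step that unfolding delta_step_def L1_def by auto
    then show ?thesis by linarith
  qed
  have "real (f ?n (c + 1) (b + c + 2)) = ucoef a b c" if "a + b + c = 2 * n" for a b c
    using that
  proof (induction a arbitrary: b rule: induct_nat_012)
    case 0
    then have "f ?n (c + 1) (b + c + 2) = 0"
      using step unfolding delta_step_def by auto
    then show ?case by (simp add: ucoef_0)
  next
    case 1
    then have "b + c + 2 = 2 * ?n - 1" "c + 1 \<in> {1..2 * ?n - 2}"
      by auto
    then have "f ?n (c + 1) (b + c + 2) = row_sum f n (c + 1)"
      using step unfolding delta_step_def by (metis diff_Suc_1)
    then show ?case
      using row_sum_closed_form [OF prev, of b c] 1 by simp
  next
    case (ge2 a)
    have "real (f n (c + 1) (b + c + 2)) = ucoef a b c"
      using prev ge2.prems by (simp add: closed_form_def)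
    moreover have "real (f ?n (c + 1) (b + c + 2 + 1)) = ucoef (Suc a) (Suc b) c"
      "real (f ?n (c + 1) (b + c + 2 + 2)) = ucoef a (Suc (Suc b)) c"
      using ge2.IH(2) [of "Suc b"] ge2.IH(1) [of "Suc (Suc b)"] ge2.prems by simp_all
    moreover have "1 \<le> c + 1" "c + 1 < b + c + 2" "b + c + 2 \<le> 2 * n"
      using ge2.prems by auto
    ultimately show ?case
      using upper_rec [of "c + 1" "b + c + 2"] egf3_recurrence [OF D_D_Ugf(1), of a b c]
      unfolding ucoef_def by linarith
  qed
  moreover have "real (f ?n (b + c + 2) (c + 1)) = lcoef a b c" if "a + b + c = 2 * n" for a b c
    using that
  proof (induction a arbitrary: b rule: induct_nat_012)
    case 0
    show ?case
    proof (cases b)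
      \<comment> \<open>Column 2n - 1 of the last row lies outside the row-sum rule and holds 0.
        Here \<open>c = 2 * n > 0\<close>, so \<open>lcoef_0_0\<close> gives 0 too.\<close>
      case b0: 0
      with 0 have "c + 1 = 2 * ?n - 1" "b + c + 2 = 2 * ?n"
        by auto
      then have "f ?n (b + c + 2) (c + 1) = 0"
        using step unfolding delta_step_def by metis
      then show ?thesis
        using 0 b0 \<open>n \<ge> 1\<close> by (simp add: lcoef_0_0)
    next
      case (Suc b')
      with 0 have "c + 1 \<in> {1..2 * ?n - 2}" "b + c + 2 = 2 * ?n"
        by auto
      then have "f ?n (b + c + 2) (c + 1) = row_sum f n (c + 1)"
        using step unfolding delta_step_def by (metis diff_Suc_1)
      then show ?thesis
        using row_sum_closed_form [OF prev, of b' c] 0 Suc by (simp add: lcoef_0_Suc)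
    qed
  next
    case 1
    then have "b + c + 2 = 2 * ?n - 1" "c + 1 \<in> {1..2 * ?n - 2}"
      by auto
    then have "f ?n (b + c + 2) (c + 1) = row_sum f n (c + 1) + col_sum f n (c + 1)"
      using step unfolding delta_step_def by (metis diff_Suc_1)
    then show ?case
      using row_sum_closed_form [OF prev, of b c] col_sum_closed_form [OF prev, of b c] lcoef_1 [of b c] 1
      by simp
  next
    case (ge2 a)
    have "real (f n (b + c + 2) (c + 1)) = lcoef a b c"
      using prev ge2.prems by (simp add: closed_form_def)
    moreover have "real (f ?n (b + c + 2 + 1) (c + 1)) = lcoef (Suc a) (Suc b) c"
      "real (f ?n (b + c + 2 + 2) (c + 1)) = lcoef a (Suc (Suc b)) c"
      using ge2.IH(2) [of "Suc b"] ge2.IH(1) [of "Suc (Suc b)"] ge2.prems by simp_all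
    moreover have "1 \<le> c + 1" "c + 1 < b + c + 2" "b + c + 2 \<le> 2 * n"
      using ge2.prems by auto
    ultimately show ?case
      using lower_rec [of "c + 1" "b + c + 2"] egf3_recurrence [OF D_D_Lgf(1), of a b c]
      unfolding lcoef_def by linarith
  qed
  moreover have "\<forall>m\<in>{1..2 * ?n}. f ?n m m = 0"
    using step unfolding delta_step_def by blast
  ultimately show ?thesis
    unfolding closed_form_def by simp
qed

lemma delta_sequence_closed_form:
  assumes "delta_sequence f" "n \<ge> 1"
  shows "closed_form f n"
  using assms(2)
proof (induction n rule: nat_induct_at_least)
  case base
  have *: "f 1 1 1 = 0" "f 1 2 2 = 0" "f 1 1 2 = 0" "f 1 2 1 = 1"
    using assms(1) by (auto simp: delta_sequence_def)
  have "f 1 m m = 0" if "m \<in> {1..2 * 1}" for m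
  proof -
    from that have "m = 1 \<or> m = 2" by auto
    with * show ?thesis by auto
  qed
  then show ?case
    unfolding closed_form_def using * by (auto simp: ucoef_0 lcoef_0_0 numeral_2_eq_2)
next
  case (Suc n)
  have "delta_step f (Suc n)"
    using assms(1) Suc.hyps by (simp add: delta_sequence_def)
  with Suc show ?case
    by (intro closed_form_step) auto
qed

section \<open>Substituted series and the quotient on the right-hand side\<close>

lemma coeff3_sum: "coeff3 (sum F A) a b c = (\<Sum>i\<in>A. coeff3 (F i) a b c)"
  by (simp add: coeff3_def fps_sum_nth)

lemma coeff3_const3_mult: "coeff3 (const3 r * F) a b c = r * coeff3 F a b c"
  by (simp add: coeff3_def const3_def)

lemma coeff3_monomial:
  "coeff3 (X3 ^ i * Y3 ^ j * Z3 ^ k) a b c = (if a = i \<and> b = j \<and> c = k then 1 else 0)"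
proof -
  have "X3 ^ i * Y3 ^ j = fps_const (fps_const (fps_X ^ i) * fps_X ^ j)"
    by (simp add: X3_def Y3_def fps_const_power flip: fps_const_mult)
  then show ?thesis
    by (auto simp: coeff3_def Z3_def)
qed

lemma const3_power: "const3 r ^ i = const3 (r ^ i)"
  by (simp add: const3_def fps_const_power)

lemma coeff3_subst3: "coeff3 (subst3 F G) a b c = (\<Sum>i\<le>a + b + c. F $ i * coeff3 (G ^ i) a b c)"
  by (simp add: coeff3_def subst3_def)

text \<open>Only the \<open>N\<close>-th power of \<open>G\<close> can contain the monomial, and the
  bound on \<open>N\<close> keeps it below the cutoff of \<open>subst3\<close>.\<close>

lemma coeff3_subst3_single:
  assumes "\<And>i. coeff3 (G ^ i) a b c = (if i = N then v else 0)" "N \<le> a + b + c"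
  shows "coeff3 (subst3 F (const3 r * G)) a b c = F $ N * r ^ N * v"
proof -
  have "coeff3 (subst3 F (const3 r * G)) a b c =
      (\<Sum>i\<le>a + b + c. if i = N then F $ N * r ^ N * v else 0)"
    unfolding coeff3_subst3 power_mult_distrib const3_power coeff3_const3_mult assms(1)
    by (intro sum.cong) auto
  with assms(2) show ?thesis
    by simp
qed

lemma fps3_eqI: "(\<And>a b c. coeff3 F a b c = coeff3 G a b c) \<Longrightarrow> F = G"
  by (simp add: coeff3_def fps_eq_iff)

lemma in_sum_X: "in_sum fps_X = X3 + Y3 + Z3"
proof (rule fps3_eqI)
  fix a b c :: nat
  have "a + b + c \<noteq> 1 \<or> a = 1 \<and> b = 0 \<and> c = 0 \<or> a = 0 \<and> b = 1 \<and> c = 0 \<or> a = 0 \<and> b = 0 \<and> c = 1"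
    by arith
  then show "coeff3 (in_sum fps_X) a b c = coeff3 (X3 + Y3 + Z3) a b c"
    by (elim disjE conjE) (auto simp: coeff3_in_sum, auto simp: coeff3_def X3_def Y3_def Z3_def)
qed

lemma sin3_x: "sin3 (const3 r * X3) = in_x (fps_sin r)"
proof (rule fps3_eqI)
  fix a b c
  have "coeff3 (X3 ^ i) a b c = (if i = a then if b = 0 \<and> c = 0 then 1 else 0 else 0)" for i
    using coeff3_monomial [of i 0 0] by auto
  then show "coeff3 (sin3 (const3 r * X3)) a b c = coeff3 (in_x (fps_sin r)) a b c"
    unfolding sin3_def by (subst coeff3_subst3_single) (auto simp: coeff3_def in_x_def fps_sin_def)
qed

lemma sin3_z: "sin3 (const3 r * Z3) = in_z (fps_sin r)"
proof (rule fps3_eqI)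
  fix a b c
  have "coeff3 (Z3 ^ i) a b c = (if i = c then if a = 0 \<and> b = 0 then 1 else 0 else 0)" for i
    using coeff3_monomial [of 0 0 i] by auto
  then show "coeff3 (sin3 (const3 r * Z3)) a b c = coeff3 (in_z (fps_sin r)) a b c"
    unfolding sin3_def by (subst coeff3_subst3_single) (auto simp: coeff3_def in_z_def fps_sin_def)
qed

lemma in_sum_add: "in_sum (F + G) = in_sum F + in_sum G"
  by (simp add: in_sum_def fps_split_add)

lemma in_sum_power: "in_sum F ^ i = in_sum (F ^ i)"
  by (induction i) (simp_all add: in_sum_mult)

text \<open>Powers of x + y + z are images of powers of \<open>fps_X\<close> under the homomorphism
  \<open>in_sum\<close>, which supplies the trinomial coefficients.\<close>

lemma cos3_sum: "cos3 (const3 r * (X3 + Y3 + Z3)) = in_sum (fps_cos r)"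
proof (rule fps3_eqI)
  fix a b c
  have "coeff3 ((X3 + Y3 + Z3) ^ i) a b c =
      (if i = a + b + c then real ((b + c) choose b) * real ((a + b + c) choose a) else 0)" for i
    by (simp add: in_sum_power coeff3_in_sum flip: in_sum_X)
  then show "coeff3 (cos3 (const3 r * (X3 + Y3 + Z3))) a b c = coeff3 (in_sum (fps_cos r)) a b c"
    unfolding cos3_def by (subst coeff3_subst3_single) (auto simp: coeff3_in_sum fps_cos_def)
qed

lemma quotient_eq_Ugf:
  "sin3 (const3 (sqrt 2) * X3) * sin3 (const3 (sqrt 2) * Z3)
      / (2 * cos3 (const3 (1 / sqrt 2) * (X3 + Y3 + Z3)) ^ 2) = Ugf" (is "?N / ?D = _")
proof -
  define u w where "u = fps_cos (1 / sqrt 2)" and "w = fps_sin (1 / sqrt 2)"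
  \<comment> \<open>Double angle formula, since \<surd>2 is twice 1/\<surd>2; it leads to 1 +
    cos(\<surd>2 w) = 2 cos^2 (w/\<surd>2).\<close>
  have "C = u * u - w * w"
    unfolding u_def w_def fps_cos_add [symmetric] by (simp add: real_div_sqrt)
  moreover have "u * u + w * w = 1"
    using fps_sin_cos_sum_of_squares [of "1 / sqrt 2"] by (simp add: u_def w_def power2_eq_square)
  ultimately have "1 + C = u ^ 2 + u ^ 2"
    by algebra
  then have "in_sum (1 + C) = in_sum (u ^ 2 + u ^ 2)"
    by simp
  also have "\<dots> = ?D"
    unfolding in_sum_add cos3_sum in_sum_power u_def by simp
  finally have "Ugf * ?D = in_x S * in_z S * in_sum (T * (1 + C))"
    by (simp only: Ugf_def prod3_def in_sum_mult mult.assoc)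
  then have "Ugf * ?D = ?N"
    by (simp add: T_mult sin3_x sin3_z)
  \<comment> \<open>The denominator has constant term 2, so the division is exact and
    \<open>?D\<close> can be cancelled.\<close>
  moreover have "?N / ?D * ?D = ?N"
    by (rule fps3_divide_mult) (simp add: coeff3_cos3_0)
  moreover have "?D \<noteq> 0"
    using coeff3_cos3_0 by (metis coeff3_def fps_zero_nth zero_neq_numeral)
  ultimately show ?thesis
    by (metis mult_right_cancel)
qed

text \<open>The sines are odd and \<open>T\<close> is even, so only even total degrees occur, as on
  the left, where term n has degree 2n - 2.\<close>

lemma coeff3_Ugf_odd:
  assumes "odd (a + b + c)"
  shows "coeff3 Ugf a b c = 0"
proof -
  have "S $ i * S $ j * coeff3 (in_sum T) (a - i) b (c - j) = 0" if "i \<le> a" "j \<le> c" for i j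
  proof (cases "even i \<or> even j")
    case False
    with assms that have "odd (a - i + b + (c - j))"
      by auto
    then show ?thesis
      by (simp add: coeff3_in_sum even_T)
  qed (auto simp: fps_sin_def)
  then show ?thesis
    unfolding Ugf_def coeff3_prod3 by (intro sum.neutral ballI) auto
qed

lemma formal_sum3I:
  assumes "\<And>n a b c. n \<ge> 1 \<Longrightarrow>
    coeff3 (t n) a b c = (if n = (a + b + c + 2) div 2 then coeff3 F a b c else 0)"
  shows "formal_sum3 t {1..} F"
  unfolding formal_sum3_def
proof (intro allI)
  fix a b c
  have "{n \<in> {1..}. coeff3 (t n) a b c \<noteq> 0} =
      (if coeff3 F a b c = 0 then {} else {(a + b + c + 2) div 2})"
    using assms by (auto split: if_splits)
  then show "finite {n \<in> {1..}. coeff3 (t n) a b c \<noteq> 0} \<and>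
      (\<Sum>n | n \<in> {1..} \<and> coeff3 (t n) a b c \<noteq> 0. coeff3 (t n) a b c) = coeff3 F a b c"
    using assms [of "(a + b + c + 2) div 2" a b c] by simp
qed

theorem theorem1p4:
  fixes f :: "nat \<Rightarrow> nat \<Rightarrow> nat \<Rightarrow> nat"
  assumes "delta_sequence f"
  shows "formal_sum3
    (\<lambda>n. \<Sum>(m, k) \<in> {(m, k). 2 \<le> m + 1 \<and> m + 1 \<le> k \<and> k \<le> 2 * n - 1}.
        const3 (real (f n m k))
        * (const3 (1 / fact (2 * n - k)) * X3 ^ (2 * n - k))
        * (const3 (1 / fact (k - m - 1)) * Y3 ^ (k - m - 1))
        * (const3 (1 / fact (m - 1)) * Z3 ^ (m - 1)))
    {1..}
    (sin3 (const3 (sqrt 2) * X3) * sin3 (const3 (sqrt 2) * Z3)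
      / (2 * cos3 (const3 (1 / sqrt 2) * (X3 + Y3 + Z3)) ^ 2))"
    (is "formal_sum3 ?t _ _")
proof -
  have coeff: "coeff3 (?t n) a b c = (if n = (a + b + c + 2) div 2 then coeff3 Ugf a b c else 0)"
    if "n \<ge> 1" for n a b c
  proof -
    let ?I = "{(m, k). 2 \<le> m + 1 \<and> m + 1 \<le> k \<and> k \<le> 2 * n - 1}"
    have fin: "finite ?I"
      by (rule finite_subset [of _ "{..2 * n} \<times> {..2 * n}"]) auto
    have mono: "const3 p * (const3 q * X) * (const3 r * Y) * (const3 s * Z)
        = const3 (p * q * r * s) * (X * Y * Z)" for p q r s X Y Z
      by (simp add: const3_def ac_simps flip: fps_const_mult)
    have "coeff3 (?t n) a b c = (\<Sum>x\<in>?I. if x = (c + 1, b + c + 2) then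
        if 2 * n = a + b + c + 2 then real (f n (c + 1) (b + c + 2)) / (fact a * fact b * fact c) else 0
        else 0)"
      unfolding coeff3_sum
    proof (rule sum.cong [OF refl], clarify)
      fix m k assume "2 \<le> m + 1" "m + 1 \<le> k" "k \<le> 2 * n - 1"
      \<comment> \<open>The exponents and n determine m and k; within these bounds no subtraction is
        truncated.\<close>
      then have "(a = 2 * n - k \<and> b = k - m - 1 \<and> c = m - 1) \<longleftrightarrow>
          (m, k) = (c + 1, b + c + 2) \<and> 2 * n = a + b + c + 2"
        by auto
      then show "coeff3 (const3 (real (f n m k))
        * (const3 (1 / fact (2 * n - k)) * X3 ^ (2 * n - k))
        * (const3 (1 / fact (k - m - 1)) * Y3 ^ (k - m - 1))
        * (const3 (1 / fact (m - 1)) * Z3 ^ (m - 1))) a b c =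
       (if (m, k) = (c + 1, b + c + 2) then
        if 2 * n = a + b + c + 2 then real (f n (c + 1) (b + c + 2)) / (fact a * fact b * fact c) else 0
        else 0)"
        unfolding mono coeff3_const3_mult coeff3_monomial by auto
    qed
    also have "\<dots> = (if (c + 1, b + c + 2) \<in> ?I \<and> 2 * n = a + b + c + 2 then
         real (f n (c + 1) (b + c + 2)) / (fact a * fact b * fact c) else 0)"
      by (simp only: sum.delta [OF fin]) auto
    also have "\<dots> = (if 2 * n = a + b + c + 2 then coeff3 Ugf a b c else 0)"
    proof (cases "2 * n = a + b + c + 2")
      case True
      then have "real (f n (c + 1) (b + c + 2)) = coeff3 Ugf a b c * fact a * fact b * fact c"
        using delta_sequence_closed_form [OF assms that] by (simp add: closed_form_def ucoef_def egf3_def)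
      \<comment> \<open>The index set stops at column 2n - 1; \<open>a = 0\<close> is column 2n,
        where \<open>Ugf\<close> contributes nothing.\<close>
      moreover have "(c + 1, b + c + 2) \<in> ?I \<longleftrightarrow> a \<noteq> 0"
        using True by auto
      moreover have "coeff3 Ugf 0 b c = 0"
        using ucoef_0(1) [of b c] by (simp add: ucoef_def egf3_def)
      ultimately show ?thesis
        using True by auto
    qed simp
    \<comment> \<open>In odd total degree the rounded \<open>div\<close> names some n although 2n =
      a + b + c + 2 is impossible; there the coefficient of \<open>Ugf\<close> is zero.\<close>
    also have "\<dots> = (if n = (a + b + c + 2) div 2 then coeff3 Ugf a b c else 0)"
    proof (cases "even (a + b + c)")
      case True
      then show ?thesis by (auto elim!: evenE)
    qed (simp add: coeff3_Ugf_odd)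
    finally show ?thesis .
  qed
  show ?thesis
    unfolding quotient_eq_Ugf by (rule formal_sum3I) (rule coeff)
qed

end
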